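(* Consider the two-period setting described in the context. Assume: (Irreversible treatment) $D_{i,1}=1\implies D_{i,2}=1$ almost surely. (Exclusion) For each $z\in\{0,1\}$, $Y_{i,t}(0,z)=Y_{i,t}(0)$ and $Y_{i,t}(1,0,z)=Y_{i,t}(1,0)$ for $t\in\{1,2\}$, and $Y_{i,2}(1,1,z)=Y_{i,2}(1,1)$ (that is, potential outcomes do not depend on $z$). (Independence) $\big(Y_{i,1}(0),Y_{i,1}(1,0),Y_{i,2}(0),Y_{i,2}(1,0),Y_{i,2}(1,1),D_{i,1}(1),D_{i,1}(0),D_{i,2}(1),D_{i,2}(0)\big)$ is independent of $Z_i$. (Relevance at $t=1$) $FS_1\neq 0$. (Monotonicity at $t=1$) $\mathbb{P}(F_1)=0$. Then $$RF_2=\mathbb{P}(C_1)\Delta_2^1(C_1)-\mathbb{P}(C_1,AT_2)\Delta_2^0(C_1,AT_2)-\mathbb{P}(NT_1,F_2)\Delta_2^0(NT_1,F_2)+\mathbb{P}(NT_1,C_2)\Delta_2^0(NT_1,C_2)$$ and $$FS_2=\mathbb{P}(C_1)-\mathbb{P}(C_1,AT_2)-\mathbb{P}(NT_1,F_2)+\mathbb{P}(NT_1,C_2).$$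
   Context: Setting. Time is $t\in\{1,2\}$; $i$ denotes a generic observation. $Z_i\in\{0,1\}$ is a time-invariant binary instrument with $0<\mathbb{P}(Z_i=1)<1$. $D_{i,t}(z)\in\{0,1\}$ is the potential treatment status at $t$ under instrument value $z$, and the observed status is $D_{i,t}=D_{i,t}(Z_i)$. No unit is treated before period 1. $Y_{i,t}(0,z)$ is the potential outcome at $t$ if $i$ has not been treated up to $t$ and the instrument is $z$; $Y_{i,t}(1,\tau,z)$, $\tau\in\{0,\dots,t-1\}$, is the potential outcome at $t$ if $i$ is first treated at period $t-\tau$ and the instrument is $z$. The observed outcome $Y_{i,t}$ equals $Y_{i,t}(0,Z_i)$ if $i$ has not been treated up to $t$, and $Y_{i,t}(1,t-s,Z_i)$ if $i$ was first treated at $s\le t$. All expectations written are assumed to exist (one may take all potential outcomes to be integrable). Latent types at $t$ (events): $AT_t=\{D_{i,t}(1)=D_{i,t}(0)=1\}$, $C_t=\{D_{i,t}(1)>D_{i,t}(0)\}$, $F_t=\{D_{i,t}(1)<D_{i,t}(0)\}$, $NT_t=\{D_{i,t}(1)=D_{i,t}(0)=0\}$. A pair such as $(C_1,AT_2)$ denotes the intersection $C_1\cap AT_2$. Estimands: $RF_t=\mathbb{E}[Y_{i,t}\mid Z_i=1]-\mathbb{E}[Y_{i,t}\mid Z_i=0]$ and $FS_t=\mathbb{E}[D_{i,t}\mid Z_i=1]-\mathbb{E}[D_{i,t}\mid Z_i=0]$. Causal effects (under exclusion): for a latent group $g$, $\Delta_t^\tau(g)=\mathbb{E}[Y_{i,t}(1,\tau)-Y_{i,t}(0)\mid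 g]$. A product $\mathbb{P}(g)\Delta_t^\tau(g)$ with $\mathbb{P}(g)=0$ is read as $0$. *)

theory Defs
  imports "HOL-Probability.Probability"
begin

text \<open>
  Encoding. Periods are the naturals 1 and 2. Binary variables (instrument, treatment status) are
  boolean, with \<open>True\<close> for 1 and \<open>False\<close> for 0, so that the order on \<open>bool\<close> is the order on 0/1.
  The argument \<open>D t z \<omega>\<close> is the potential treatment \<open>D\<^sub>t(z)\<close>; \<open>Yz0 t z \<omega>\<close> and \<open>Yz1 t \<tau> z \<omega>\<close> are the
  potential outcomes \<open>Y\<^sub>t(0,z)\<close> and \<open>Y\<^sub>t(1,\<tau>,z)\<close>; \<open>Y0 t \<omega>\<close> and \<open>Y1 t \<tau> \<omega>\<close> are the
  versions \<open>Y\<^sub>t(0)\<close> and \<open>Y\<^sub>t(1,\<tau>)\<close> that do not depend on the instrument.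
\<close>

text \<open>
  Expectation conditional on an event. Division by zero yields 0 when the event is null, so a
  product of its probability with a conditional expectation is then 0.
\<close>
definition cond_exp_on :: "'a measure \<Rightarrow> ('a \<Rightarrow> real) \<Rightarrow> 'a set \<Rightarrow> real" where
  "cond_exp_on M X A = (LINT \<omega>:A|M. X \<omega>) / measure M A"

text \<open>
  The characterization \<open>indep_var_eq\<close> of the library's \<open>indep_var\<close>, which requires both random
  variables to have the same value type, stated for variables with different value types.
\<close>
definition indep_rv ::
  "'a measure \<Rightarrow> 'b measure \<Rightarrow> ('a \<Rightarrow> 'b) \<Rightarrow> 'c measure \<Rightarrow> ('a \<Rightarrow> 'c) \<Rightarrow> bool" where
  "indep_rv M S X T Y \<longleftrightarrow>
     X \<in> M \<rightarrow>\<^sub>M S \<and> Y \<in> M \<rightarrow>\<^sub>M T \<and>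
     prob_space.indep_set M
       (sigma_sets (space M) {X -` A \<inter> space M | A. A \<in> sets S})
       (sigma_sets (space M) {Y -` B \<inter> space M | B. B \<in> sets T})"

definition obs_treatment ::
  "('a \<Rightarrow> bool) \<Rightarrow> (nat \<Rightarrow> bool \<Rightarrow> 'a \<Rightarrow> bool) \<Rightarrow> nat \<Rightarrow> 'a \<Rightarrow> bool" where
  "obs_treatment Z D t \<omega> = D t (Z \<omega>) \<omega>"

text \<open>Periods start at 1, which encodes that no unit is treated earlier.\<close>
definition treated_by ::
  "('a \<Rightarrow> bool) \<Rightarrow> (nat \<Rightarrow> bool \<Rightarrow> 'a \<Rightarrow> bool) \<Rightarrow> nat \<Rightarrow> 'a \<Rightarrow> bool" where
  "treated_by Z D t \<omega> \<longleftrightarrow> (\<exists>s\<in>{1..t}. obs_treatment Z D s \<omega>)"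

text \<open>Only meaningful for units treated at some period.\<close>
definition first_treated ::
  "('a \<Rightarrow> bool) \<Rightarrow> (nat \<Rightarrow> bool \<Rightarrow> 'a \<Rightarrow> bool) \<Rightarrow> 'a \<Rightarrow> nat" where
  "first_treated Z D \<omega> = (LEAST s. 1 \<le> s \<and> obs_treatment Z D s \<omega>)"

definition obs_outcome ::
  "('a \<Rightarrow> bool) \<Rightarrow> (nat \<Rightarrow> bool \<Rightarrow> 'a \<Rightarrow> bool) \<Rightarrow> (nat \<Rightarrow> bool \<Rightarrow> 'a \<Rightarrow> real) \<Rightarrow>
    (nat \<Rightarrow> nat \<Rightarrow> bool \<Rightarrow> 'a \<Rightarrow> real) \<Rightarrow> nat \<Rightarrow> 'a \<Rightarrow> real" where
  "obs_outcome Z D Yz0 Yz1 t \<omega> =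
     (if treated_by Z D t \<omega> then Yz1 t (t - first_treated Z D \<omega>) (Z \<omega>) \<omega> else Yz0 t (Z \<omega>) \<omega>)"

definition always_takers :: "'a measure \<Rightarrow> (nat \<Rightarrow> bool \<Rightarrow> 'a \<Rightarrow> bool) \<Rightarrow> nat \<Rightarrow> 'a set" where
  "always_takers M D t = {\<omega> \<in> space M. D t True \<omega> = True \<and> D t False \<omega> = True}"

definition compliers :: "'a measure \<Rightarrow> (nat \<Rightarrow> bool \<Rightarrow> 'a \<Rightarrow> bool) \<Rightarrow> nat \<Rightarrow> 'a set" where
  "compliers M D t = {\<omega> \<in> space M. D t True \<omega> > D t False \<omega>}"

definition defiers :: "'a measure \<Rightarrow> (nat \<Rightarrow> bool \<Rightarrow> 'a \<Rightarrow> bool) \<Rightarrow> nat \<Rightarrow> 'a set" where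
  "defiers M D t = {\<omega> \<in> space M. D t True \<omega> < D t False \<omega>}"

definition never_takers :: "'a measure \<Rightarrow> (nat \<Rightarrow> bool \<Rightarrow> 'a \<Rightarrow> bool) \<Rightarrow> nat \<Rightarrow> 'a set" where
  "never_takers M D t = {\<omega> \<in> space M. D t True \<omega> = False \<and> D t False \<omega> = False}"

text \<open>
  The difference \<open>E[X | Z = 1] - E[X | Z = 0]\<close>; the reduced form is the case of the observed
  outcome, the first stage that of the observed treatment.
\<close>
definition instrument_contrast :: "'a measure \<Rightarrow> ('a \<Rightarrow> bool) \<Rightarrow> ('a \<Rightarrow> real) \<Rightarrow> real" where
  "instrument_contrast M Z X =
     cond_exp_on M X {\<omega> \<in> space M. Z \<omega>} - cond_exp_on M X {\<omega> \<in> space M. \<not> Z \<omega>}"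

definition reduced_form ::
  "'a measure \<Rightarrow> ('a \<Rightarrow> bool) \<Rightarrow> (nat \<Rightarrow> bool \<Rightarrow> 'a \<Rightarrow> bool) \<Rightarrow> (nat \<Rightarrow> bool \<Rightarrow> 'a \<Rightarrow> real) \<Rightarrow>
    (nat \<Rightarrow> nat \<Rightarrow> bool \<Rightarrow> 'a \<Rightarrow> real) \<Rightarrow> nat \<Rightarrow> real" where
  "reduced_form M Z D Yz0 Yz1 t = instrument_contrast M Z (obs_outcome Z D Yz0 Yz1 t)"

definition first_stage ::
  "'a measure \<Rightarrow> ('a \<Rightarrow> bool) \<Rightarrow> (nat \<Rightarrow> bool \<Rightarrow> 'a \<Rightarrow> bool) \<Rightarrow> nat \<Rightarrow> real" where
  "first_stage M Z D t = instrument_contrast M Z (\<lambda>\<omega>. of_bool (obs_treatment Z D t \<omega>))"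

text \<open>The average effect \<open>\<Delta>\<^sub>t\<^sup>\<tau>(g)\<close>, in period \<open>t\<close>, of first treatment in period \<open>t - \<tau>\<close>.\<close>
definition causal_effect ::
  "'a measure \<Rightarrow> (nat \<Rightarrow> 'a \<Rightarrow> real) \<Rightarrow> (nat \<Rightarrow> nat \<Rightarrow> 'a \<Rightarrow> real) \<Rightarrow> nat \<Rightarrow> nat \<Rightarrow> 'a set \<Rightarrow> real" where
  "causal_effect M Y0 Y1 t \<tau> g = cond_exp_on M (\<lambda>\<omega>. Y1 t \<tau> \<omega> - Y0 t \<omega>) g"

end

theory Submission
  imports Defs
begin

text \<open>
  Write \<open>W z\<close> for the period-2 outcome along the treatment path chosen under instrument value \<open>z\<close>.
  Independence turns each conditional expectation given \<open>Z = z\<close> into the unconditional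
  expectation of \<open>W z\<close>, so the reduced form is the mean of \<open>W True - W False\<close>. It also
  transfers irreversibility from the observed to both potential treatment paths. Outside the
  null events, \<open>W True - W False\<close> is then a signed sum of treatment effects on the latent groups. The
  first stage is the special case of an outcome that is 1 once treated and 0 before.
\<close>

section \<open>Consequences of independence, and conditional expectations given the
  instrument\<close>

lemma (in prob_space) indep_rv_prob_Int:
  assumes "indep_rv M S V T Z" "A \<in> sets S" "B \<in> sets T"
  shows "prob (V -` A \<inter> space M \<inter> (Z -` B \<inter> space M))
    = prob (V -` A \<inter> space M) * prob (Z -` B \<inter> space M)"
  using assms unfolding indep_rv_def
  by (intro indep_setD[where A = "sigma_sets (space M) {V -` A \<inter> space M | A. A \<in> sets S}"
        and B = "sigma_sets (space M) {Z -` B \<inter> space M | B. B \<in> sets T}"])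
     (auto intro: sigma_sets.Basic)

text \<open>Bridge to \<open>indep_var\<close>, which forces a common value type and carries the
  product rule for expectations: \<open>f\<close> and \<open>h\<close> map into one type. Preimages
  under a composition are preimages under the original variable, so the generated sigma-algebras
  only shrink and independence survives.\<close>

lemma (in prob_space) indep_rv_indep_var:
  assumes ind: "indep_rv M S V T Z" and f: "f \<in> S \<rightarrow>\<^sub>M N" and h: "h \<in> T \<rightarrow>\<^sub>M N'"
  shows "indep_var N (\<lambda>\<omega>. f (V \<omega>)) N' (\<lambda>\<omega>. h (Z \<omega>))"
  unfolding indep_var_eq
proof (intro conjI)
  have V: "V \<in> M \<rightarrow>\<^sub>M S" and Z: "Z \<in> M \<rightarrow>\<^sub>M T"
    using ind by (auto simp: indep_rv_def)
  show "random_variable N (\<lambda>\<omega>. f (V \<omega>))" using measurable_compose[OF V f] .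
  show "random_variable N' (\<lambda>\<omega>. h (Z \<omega>))" using measurable_compose[OF Z h] .
  have sub: "sigma_sets (space M) {(\<lambda>\<omega>. k (U \<omega>)) -` A \<inter> space M | A. A \<in> sets L'}
      \<subseteq> sigma_sets (space M) {U -` A \<inter> space M | A. A \<in> sets L}"
    if U: "U \<in> M \<rightarrow>\<^sub>M L" and k: "k \<in> L \<rightarrow>\<^sub>M L'" for U k L L'
  proof (intro sigma_sets_mono subsetI, clarify)
    fix A assume A: "A \<in> sets L'"
    have "(\<lambda>\<omega>. k (U \<omega>)) -` A \<inter> space M = U -` (k -` A \<inter> space L) \<inter> space M"
      using measurable_space[OF U] by auto
    then show "(\<lambda>\<omega>. k (U \<omega>)) -` A \<inter> space M
        \<in> sigma_sets (space M) {U -` A \<inter> space M | A. A \<in> sets L}"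
      using measurable_sets[OF k A] by blast
  qed
  show "indep_set (sigma_sets (space M) {(\<lambda>\<omega>. f (V \<omega>)) -` A \<inter> space M | A. A \<in> sets N})
      (sigma_sets (space M) {(\<lambda>\<omega>. h (Z \<omega>)) -` A \<inter> space M | A. A \<in> sets N'})"
    using ind sub[OF V f] sub[OF Z h]
    unfolding indep_rv_def indep_set_def
    by (elim conjE, elim indep_sets_mono_sets) (simp split: bool.split)
qed

text \<open>The integral over the event is the expectation of a product of a function of
  \<open>V\<close> and an indicator of \<open>Z\<close>. Independence factors it, and the
  probability of the event cancels.\<close>

lemma (in prob_space) cond_exp_on_indep:
  fixes f :: "'b \<Rightarrow> real"
  assumes ind: "indep_rv M S V T Z" and f: "f \<in> borel_measurable S"
    and int: "integrable M (\<lambda>\<omega>. f (V \<omega>))"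
    and B: "B \<in> sets T" and pos: "prob (Z -` B \<inter> space M) \<noteq> 0"
  shows "cond_exp_on M (\<lambda>\<omega>. f (V \<omega>)) (Z -` B \<inter> space M) = expectation (\<lambda>\<omega>. f (V \<omega>))"
proof -
  have Z: "Z \<in> M \<rightarrow>\<^sub>M T" using ind by (auto simp: indep_rv_def)
  have ev: "Z -` B \<inter> space M \<in> events" using measurable_sets[OF Z B] .
  have "indep_var borel (\<lambda>\<omega>. f (V \<omega>)) borel (\<lambda>\<omega>. indicator B (Z \<omega>) :: real)"
    using B by (intro indep_rv_indep_var[OF ind f]) auto
  \<comment> \<open>Restricted to the space: outside it \<open>Z\<close> may still take values in
    \<open>B\<close>, whereas the right-hand indicator is 0 there.\<close>
  moreover have eq: "indicator B (Z \<omega>) = (indicator (Z -` B \<inter> space M) \<omega> :: real)"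
    if "\<omega> \<in> space M" for \<omega> using that by (auto simp: indicator_def)
  moreover have "integrable M (\<lambda>\<omega>. indicator B (Z \<omega>) :: real)"
    using ev by (subst Bochner_Integration.integrable_cong[OF refl eq])
      (auto intro!: integrable_real_indicator simp: emeasure_eq_measure)
  ultimately have "expectation (\<lambda>\<omega>. f (V \<omega>) * indicator B (Z \<omega>))
      = expectation (\<lambda>\<omega>. f (V \<omega>)) * expectation (\<lambda>\<omega>. indicator B (Z \<omega>))"
    using int by (intro indep_var_lebesgue_integral)
  also have "expectation (\<lambda>\<omega>. indicator B (Z \<omega>)) = prob (Z -` B \<inter> space M)"
    using ev by (subst Bochner_Integration.integral_cong[OF refl eq]) auto
  also have "expectation (\<lambda>\<omega>. f (V \<omega>) * indicator B (Z \<omega>))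
      = (LINT \<omega>:Z -` B \<inter> space M|M. f (V \<omega>))"
    unfolding set_lebesgue_integral_def
    by (intro Bochner_Integration.integral_cong) (auto simp: indicator_def)
  finally show ?thesis using pos by (simp add: cond_exp_on_def)
qed

lemma cond_exp_on_cong_AE:
  assumes "X \<in> borel_measurable M" "X' \<in> borel_measurable M" "A \<in> sets M"
    and "AE \<omega> in M. \<omega> \<in> A \<longrightarrow> X \<omega> = X' \<omega>"
  shows "cond_exp_on M X A = cond_exp_on M X' A"
  using assms unfolding cond_exp_on_def by (subst set_lebesgue_integral_cong_AE) auto

text \<open>This handles empty latent groups without a separate argument: on a null group the left
  side is 0 by convention, and the integral vanishes because its integrand is almost surely
  0.\<close>

lemma measure_mult_cond_exp_on:
  assumes "finite_measure M" "A \<in> sets M"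
  shows "measure M A * cond_exp_on M X A = (LINT \<omega>:A|M. X \<omega>)"
proof (cases "measure M A = 0")
  case True
  then have "A \<in> null_sets M"
    using assms by (auto simp: null_sets_def finite_measure.emeasure_eq_measure)
  then have "(LINT \<omega>:A|M. X \<omega>) = (LINT \<omega>|M. 0)"
    unfolding set_lebesgue_integral_def
    by (intro integral_eq_zero_AE[THEN trans]) (auto dest!: AE_not_in elim!: eventually_mono)
  with True show ?thesis by simp
qed (simp add: cond_exp_on_def)

text \<open>\<open>X\<close> may depend on \<open>Z\<close> itself, so independence does not apply
  to it directly. On the event that \<open>Z\<close> equals \<open>z\<close>, however, it agrees
  with \<open>f z\<close> at \<open>V\<close>, where the instrument is frozen, and conditioning can
  then be dropped.\<close>

lemma (in prob_space) instrument_contrast_indep: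
  fixes f :: "bool \<Rightarrow> 'b \<Rightarrow> real"
  assumes ind: "indep_rv M S V (count_space UNIV) Z"
    and pos: "0 < \<P>(\<omega> in M. Z \<omega>)" "\<P>(\<omega> in M. Z \<omega>) < 1"
    and X: "X \<in> borel_measurable M"
    and f: "\<And>z. f z \<in> borel_measurable S" and int: "\<And>z. integrable M (\<lambda>\<omega>. f z (V \<omega>))"
    and eq: "AE \<omega> in M. X \<omega> = f (Z \<omega>) (V \<omega>)"
  shows "instrument_contrast M Z X
    = expectation (\<lambda>\<omega>. f True (V \<omega>)) - expectation (\<lambda>\<omega>. f False (V \<omega>))"
proof -
  have Z [measurable]: "Z \<in> M \<rightarrow>\<^sub>M count_space UNIV" using ind by (auto simp: indep_rv_def)
  have "cond_exp_on M X {\<omega> \<in> space M. Z \<omega> = z} = expectation (\<lambda>\<omega>. f z (V \<omega>))" for z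
  proof -
    have ev: "{\<omega> \<in> space M. Z \<omega> = z} = Z -` {z} \<inter> space M" by auto
    have "prob {\<omega> \<in> space M. Z \<omega> = z} \<noteq> 0"
      using pos prob_neg[of Z] by (cases z) auto
    \<comment> \<open>The random index \<open>Z \<omega>\<close> becomes the constant
      \<open>z\<close> on the conditioning event.\<close>
    moreover have "cond_exp_on M X {\<omega> \<in> space M. Z \<omega> = z}
        = cond_exp_on M (\<lambda>\<omega>. f z (V \<omega>)) {\<omega> \<in> space M. Z \<omega> = z}"
      using X int eq by (intro cond_exp_on_cong_AE) (auto elim: eventually_mono)
    ultimately show ?thesis
      using cond_exp_on_indep[OF ind f int, of "{z}"] by (simp add: ev)
  qed
  from this[of True] this[of False] show ?thesis by (simp add: instrument_contrast_def)
qed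

text \<open>The violations of \<open>P\<close> within the event \<open>Z \<omega> = z\<close> form a
  null set whose probability factors. The factor for the instrument is positive, so the violations
  are null without conditioning.\<close>

lemma (in prob_space) AE_if_AE_on_indep_event:
  assumes ind: "indep_rv M S V (count_space UNIV) Z"
    and pos: "0 < \<P>(\<omega> in M. Z \<omega>)" "\<P>(\<omega> in M. Z \<omega>) < 1"
    and P: "{v \<in> space S. P v} \<in> sets S"
    and AE: "AE \<omega> in M. Z \<omega> = z \<longrightarrow> P (V \<omega>)"
  shows "AE \<omega> in M. P (V \<omega>)"
proof -
  have V: "V \<in> M \<rightarrow>\<^sub>M S" and Z [measurable]: "Z \<in> M \<rightarrow>\<^sub>M count_space UNIV"
    using ind by (auto simp: indep_rv_def)
  have P': "{v \<in> space S. \<not> P v} \<in> sets S" using sets.sets_Collect_neg[OF P] .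
  let ?A = "V -` {v \<in> space S. \<not> P v} \<inter> space M" and ?B = "Z -` {z} \<inter> space M"
  have B: "?B = {\<omega> \<in> space M. Z \<omega> = z}" by auto
  have A [measurable]: "?A \<in> events" using measurable_sets[OF V P'] .
  have "?B \<in> events" unfolding B by measurable
  have "prob (?A \<inter> ?B) = prob ?A * prob ?B"
    using indep_rv_prob_Int[OF ind P', of "{z}"] by simp
  moreover have "AE \<omega> in M. \<omega> \<notin> ?A \<inter> ?B"
    using AE by eventually_elim auto
  then have "prob (?A \<inter> ?B) = 0"
    using prob_eq_0[OF sets.Int[OF A \<open>?B \<in> events\<close>]] by blast
  moreover have "prob ?B \<noteq> 0"
    unfolding B using pos prob_neg[of Z] by (cases z) auto
  ultimately have "prob ?A = 0" by simp
  then have "AE \<omega> in M. \<omega> \<notin> ?A" using prob_eq_0[OF A] by blast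
  then show ?thesis using AE_space
    by eventually_elim (use measurable_space[OF V] in auto)
qed

section \<open>Outcomes along a treatment path and their decomposition by latent type\<close>

definition path_outcome :: "bool \<Rightarrow> bool \<Rightarrow> real \<Rightarrow> real \<Rightarrow> real \<Rightarrow> real" where
  "path_outcome d1 d2 a b c = (if d1 then a else if d2 then b else c)"

text \<open>The instrument has disappeared: two potential paths of the same unit are compared
  pointwise outside null sets, then integrated. Keeping \<open>a\<close>, \<open>b\<close>,
  \<open>c\<close> arbitrary lets one decomposition serve both the reduced form and the first
  stage.\<close>

lemma (in prob_space) path_outcome_decomposition:
  assumes D: "\<And>t z. t \<in> {1, 2} \<Longrightarrow> D t z \<in> M \<rightarrow>\<^sub>M count_space UNIV"
    and a: "integrable M a" and b: "integrable M b" and c: "integrable M c"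
    and irr: "\<And>z. AE \<omega> in M. \<not> (D 1 z \<omega> \<and> \<not> D 2 z \<omega>)"
    and mono: "measure M (defiers M D 1) = 0"
  shows "expectation (\<lambda>\<omega>. path_outcome (D 1 True \<omega>) (D 2 True \<omega>) (a \<omega>) (b \<omega>) (c \<omega>))
      - expectation (\<lambda>\<omega>. path_outcome (D 1 False \<omega>) (D 2 False \<omega>) (a \<omega>) (b \<omega>) (c \<omega>))
    = (LINT \<omega>:compliers M D 1|M. a \<omega> - c \<omega>)
      - (LINT \<omega>:compliers M D 1 \<inter> always_takers M D 2|M. b \<omega> - c \<omega>)
      - (LINT \<omega>:never_takers M D 1 \<inter> defiers M D 2|M. b \<omega> - c \<omega>)
      + (LINT \<omega>:never_takers M D 1 \<inter> compliers M D 2|M. b \<omega> - c \<omega>)"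
proof -
  have [measurable]: "D 1 z \<in> M \<rightarrow>\<^sub>M count_space UNIV" "D 2 z \<in> M \<rightarrow>\<^sub>M count_space UNIV" for z
    using D by auto
  have ev: "compliers M D 1 \<in> events" "compliers M D 1 \<inter> always_takers M D 2 \<in> events"
     "never_takers M D 1 \<inter> defiers M D 2 \<in> events"
     "never_takers M D 1 \<inter> compliers M D 2 \<in> events" "defiers M D 1 \<in> events"
    unfolding compliers_def always_takers_def never_takers_def defiers_def less_bool_def
    by measurable
  let ?W = "\<lambda>z \<omega>. path_outcome (D 1 z \<omega>) (D 2 z \<omega>) (a \<omega>) (b \<omega>) (c \<omega>)"
  let ?I = "\<lambda>A X \<omega>. indicator A \<omega> *\<^sub>R (X \<omega> :: real)"
  have [measurable]: "a \<in> borel_measurable M" "b \<in> borel_measurable M" "c \<in> borel_measurable M"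
    using a b c by auto
  have W: "integrable M (?W z)" for z
  proof (rule Bochner_Integration.integrable_bound)
    \<comment> \<open>The path outcome is always one of the three values, so the sum of their
      absolute values dominates it.\<close>
    show "integrable M (\<lambda>\<omega>. \<bar>a \<omega>\<bar> + \<bar>b \<omega>\<bar> + \<bar>c \<omega>\<bar>)" using a b c by auto
    show "?W z \<in> borel_measurable M" unfolding path_outcome_def by measurable
  qed (auto simp: path_outcome_def)
  have I: "integrable M (?I A X)" if "A \<in> events" "integrable M X" for A X
    using that by (rule integrable_mult_indicator)
  have ac: "integrable M (\<lambda>\<omega>. a \<omega> - c \<omega>)" and bc: "integrable M (\<lambda>\<omega>. b \<omega> - c \<omega>)"
    using a b c by auto
  have nodef: "AE \<omega> in M. \<omega> \<notin> defiers M D 1" using mono ev by (subst (asm) prob_eq_0) auto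
  have "expectation (?W True) - expectation (?W False)
      = expectation (\<lambda>\<omega>. ?W True \<omega> - ?W False \<omega>)"
    using W by simp
  also have "\<dots> = expectation (\<lambda>\<omega>. ?I (compliers M D 1) (\<lambda>\<omega>. a \<omega> - c \<omega>) \<omega>
      - ?I (compliers M D 1 \<inter> always_takers M D 2) (\<lambda>\<omega>. b \<omega> - c \<omega>) \<omega>
      - ?I (never_takers M D 1 \<inter> defiers M D 2) (\<lambda>\<omega>. b \<omega> - c \<omega>) \<omega>
      + ?I (never_takers M D 1 \<inter> compliers M D 2) (\<lambda>\<omega>. b \<omega> - c \<omega>) \<omega>)" (is "_ = expectation ?R")
  proof (rule integral_cong_AE)
    show "(\<lambda>\<omega>. ?W True \<omega> - ?W False \<omega>) \<in> borel_measurable M"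
      using W[of True] W[of False] by auto
    show "?R \<in> borel_measurable M" using ev by auto
    \<comment> \<open>Period-1 always-takers get \<open>a\<close> on both paths. For a period-1
      complier the \<open>True\<close> path gives \<open>a\<close>, and irreversibility forces
      \<open>D 2 True \<omega>\<close>. The \<open>False\<close> path gives \<open>c\<close>, or
      \<open>b\<close> if the unit is in \<open>always_takers M D 2\<close>; writing a - b = (a - c)
      - (b - c) yields the subtracted correction. For period-1 never-takers only the period-2 type
      matters: compliers contribute b - c, defiers its negative, and the other types 0. Period-1
      defiers are null.\<close>
    show "AE \<omega> in M. ?W True \<omega> - ?W False \<omega> = ?R \<omega>"
      using irr[of True] irr[of False] nodef AE_space
      by eventually_elim
        (auto simp: path_outcome_def compliers_def always_takers_def never_takers_def defiers_def
          less_bool_def indicator_def)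
  qed
  also have "\<dots> = (LINT \<omega>:compliers M D 1|M. a \<omega> - c \<omega>)
      - (LINT \<omega>:compliers M D 1 \<inter> always_takers M D 2|M. b \<omega> - c \<omega>)
      - (LINT \<omega>:never_takers M D 1 \<inter> defiers M D 2|M. b \<omega> - c \<omega>)
      + (LINT \<omega>:never_takers M D 1 \<inter> compliers M D 2|M. b \<omega> - c \<omega>)"
    unfolding set_lebesgue_integral_def
    by (subst Bochner_Integration.integral_add Bochner_Integration.integral_diff,
        (intro Bochner_Integration.integrable_diff I ev ac bc)+)+ simp
  finally show ?thesis .
qed

text \<open>Only the date of first treatment matters: date 1 means lag 1 and date 2 means lag 0,
  whence the order of the two treated outcomes. The identity is pointwise and needs no
  irreversibility, because a unit treated in period 1 counts as treated whatever its period-2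
  status.\<close>

lemma obs_outcome_2:
  "obs_outcome Z D Yz0 Yz1 2 \<omega>
    = path_outcome (D 1 (Z \<omega>) \<omega>) (D 2 (Z \<omega>) \<omega>)
        (Yz1 2 1 (Z \<omega>) \<omega>) (Yz1 2 0 (Z \<omega>) \<omega>) (Yz0 2 (Z \<omega>) \<omega>)"
proof -
  have tb: "treated_by Z D 2 \<omega> \<longleftrightarrow> D 1 (Z \<omega>) \<omega> \<or> D 2 (Z \<omega>) \<omega>"
    by (auto simp: treated_by_def obs_treatment_def numeral_2_eq_2 atLeastAtMostSuc_conv)
  have "first_treated Z D \<omega> = 1" if "D 1 (Z \<omega>) \<omega>"
    unfolding first_treated_def obs_treatment_def using that by (intro Least_equality) auto
  moreover have "first_treated Z D \<omega> = 2" if "\<not> D 1 (Z \<omega>) \<omega>" "D 2 (Z \<omega>) \<omega>"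
    unfolding first_treated_def obs_treatment_def
  proof (intro Least_equality)
    fix s assume s: "1 \<le> s \<and> D s (Z \<omega>) \<omega>"
    then have "s \<noteq> 1" using that by metis
    with s show "2 \<le> s" by linarith
  qed (use that in auto)
  ultimately show ?thesis by (auto simp: obs_outcome_def path_outcome_def tb)
qed

section \<open>The reduced form and the first stage in period 2\<close>

theorem proposition2p1:
  fixes M :: "'a measure"
    and Z :: "'a \<Rightarrow> bool"
    and D :: "nat \<Rightarrow> bool \<Rightarrow> 'a \<Rightarrow> bool"
    and Yz0 :: "nat \<Rightarrow> bool \<Rightarrow> 'a \<Rightarrow> real"
    and Yz1 :: "nat \<Rightarrow> nat \<Rightarrow> bool \<Rightarrow> 'a \<Rightarrow> real"
    and Y0 :: "nat \<Rightarrow> 'a \<Rightarrow> real"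
    and Y1 :: "nat \<Rightarrow> nat \<Rightarrow> 'a \<Rightarrow> real"
  assumes prob_space: "prob_space M"
    and instrument_rv: "Z \<in> M \<rightarrow>\<^sub>M count_space UNIV"
    and instrument_nondegenerate: "0 < \<P>(\<omega> in M. Z \<omega>)" "\<P>(\<omega> in M. Z \<omega>) < 1"
    and treatment_rv: "\<And>t z. t \<in> {1, 2} \<Longrightarrow> D t z \<in> M \<rightarrow>\<^sub>M count_space UNIV"
    and untreated_integrable: "\<And>t z. t \<in> {1, 2} \<Longrightarrow> integrable M (Yz0 t z)"
    and treated_integrable:
      "\<And>t \<tau> z. t \<in> {1, 2} \<Longrightarrow> \<tau> \<in> {0..t - 1} \<Longrightarrow> integrable M (Yz1 t \<tau> z)"
    and irreversible: "AE \<omega> in M. obs_treatment Z D 1 \<omega> \<longrightarrow> obs_treatment Z D 2 \<omega>"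
    and exclusion_untreated:
      "\<And>t z. t \<in> {1, 2} \<Longrightarrow> AE \<omega> in M. Yz0 t z \<omega> = Y0 t \<omega>"
    and exclusion_treated:
      "\<And>t \<tau> z. t \<in> {1, 2} \<Longrightarrow> \<tau> \<in> {0..t - 1} \<Longrightarrow> AE \<omega> in M. Yz1 t \<tau> z \<omega> = Y1 t \<tau> \<omega>"
    and independence:
      "indep_rv M
         (borel \<Otimes>\<^sub>M borel \<Otimes>\<^sub>M borel \<Otimes>\<^sub>M borel \<Otimes>\<^sub>M borel \<Otimes>\<^sub>M
           count_space UNIV \<Otimes>\<^sub>M count_space UNIV \<Otimes>\<^sub>M count_space UNIV \<Otimes>\<^sub>M count_space UNIV)
         (\<lambda>\<omega>. (Y0 1 \<omega>, Y1 1 0 \<omega>, Y0 2 \<omega>, Y1 2 0 \<omega>, Y1 2 1 \<omega>,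
           D 1 True \<omega>, D 1 False \<omega>, D 2 True \<omega>, D 2 False \<omega>))
         (count_space UNIV) Z"
    and relevance: "first_stage M Z D 1 \<noteq> 0"
    and monotonicity: "measure M (defiers M D 1) = 0"
  shows
    "reduced_form M Z D Yz0 Yz1 2 =
       measure M (compliers M D 1) * causal_effect M Y0 Y1 2 1 (compliers M D 1)
       - measure M (compliers M D 1 \<inter> always_takers M D 2)
         * causal_effect M Y0 Y1 2 0 (compliers M D 1 \<inter> always_takers M D 2)
       - measure M (never_takers M D 1 \<inter> defiers M D 2)
         * causal_effect M Y0 Y1 2 0 (never_takers M D 1 \<inter> defiers M D 2)
       + measure M (never_takers M D 1 \<inter> compliers M D 2)
         * causal_effect M Y0 Y1 2 0 (never_takers M D 1 \<inter> compliers M D 2)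
     \<and> first_stage M Z D 2 =
       measure M (compliers M D 1)
       - measure M (compliers M D 1 \<inter> always_takers M D 2)
       - measure M (never_takers M D 1 \<inter> defiers M D 2)
       + measure M (never_takers M D 1 \<inter> compliers M D 2)"
proof -
  interpret prob_space M by (fact prob_space)
  let ?S = "borel \<Otimes>\<^sub>M borel \<Otimes>\<^sub>M borel \<Otimes>\<^sub>M borel \<Otimes>\<^sub>M borel \<Otimes>\<^sub>M
    count_space UNIV \<Otimes>\<^sub>M count_space UNIV \<Otimes>\<^sub>M count_space UNIV \<Otimes>\<^sub>M count_space UNIV
    :: (real \<times> real \<times> real \<times> real \<times> real \<times> bool \<times> bool \<times> bool \<times> bool) measure"
  let ?V = "\<lambda>\<omega>. (Y0 1 \<omega>, Y1 1 0 \<omega>, Y0 2 \<omega>, Y1 2 0 \<omega>, Y1 2 1 \<omega>,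
    D 1 True \<omega>, D 1 False \<omega>, D 2 True \<omega>, D 2 False \<omega>)"
  have V: "?V \<in> M \<rightarrow>\<^sub>M ?S" using independence by (simp add: indep_rv_def)
  note [measurable] = instrument_rv
  have D [measurable]: "D 1 z \<in> M \<rightarrow>\<^sub>M count_space UNIV" "D 2 z \<in> M \<rightarrow>\<^sub>M count_space UNIV" for z
    using treatment_rv by auto
  have Yz: "integrable M (Yz0 2 z)" "integrable M (Yz1 2 0 z)" "integrable M (Yz1 2 1 z)" for z
    using untreated_integrable treated_integrable by auto
  then have [measurable]: "Yz0 2 z \<in> borel_measurable M" "Yz1 2 0 z \<in> borel_measurable M"
    "Yz1 2 1 z \<in> borel_measurable M" for z
    by auto
  have ex: "AE \<omega> in M. Yz0 2 z \<omega> = Y0 2 \<omega>" "AE \<omega> in M. Yz1 2 0 z \<omega> = Y1 2 0 \<omega>"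
    "AE \<omega> in M. Yz1 2 1 z \<omega> = Y1 2 1 \<omega>" for z
    using exclusion_untreated exclusion_treated by auto
  \<comment> \<open>Measurability comes from the joint vector in the independence assumption, by
    projection.\<close>
  have Ym [measurable]: "Y0 2 \<in> borel_measurable M" "Y1 2 0 \<in> borel_measurable M"
    "Y1 2 1 \<in> borel_measurable M"
    using measurable_compose[OF V, of "\<lambda>(_, _, y, _). y" borel]
      measurable_compose[OF V, of "\<lambda>(_, _, _, y, _). y" borel]
      measurable_compose[OF V, of "\<lambda>(_, _, _, _, y, _). y" borel]
    by auto
  \<comment> \<open>Integrability is given for the outcomes indexed by \<open>z\<close>; exclusion
    transfers it, and either value of \<open>z\<close> would do.\<close>
  have Y: "integrable M (Y0 2)" "integrable M (Y1 2 0)" "integrable M (Y1 2 1)"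
    using integrable_cong_AE_imp[OF Yz(1) Ym(1), of True] ex(1)[of True]
      integrable_cong_AE_imp[OF Yz(2) Ym(2), of True] ex(2)[of True]
      integrable_cong_AE_imp[OF Yz(3) Ym(3), of True] ex(3)[of True]
    by (auto simp: eq_commute)
  \<comment> \<open>Irreversibility is assumed only for the observed path. On the event
    \<open>Z \<omega> = z\<close> that path is the potential path under \<open>z\<close>, a function
    of the vector independent of \<open>Z\<close>, so the restriction extends to all units.\<close>
  have irr: "AE \<omega> in M. \<not> (D 1 z \<omega> \<and> \<not> D 2 z \<omega>)" for z
  proof -
    let ?P = "\<lambda>(_ :: real, _ :: real, _ :: real, _ :: real, _ :: real, d1, d1', d2, d2').
      \<not> ((if z then d1 else d1') \<and> \<not> (if z then d2 else d2'))"
    have "AE \<omega> in M. ?P (?V \<omega>)"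
    proof (rule AE_if_AE_on_indep_event[OF independence instrument_nondegenerate, where z = z])
      show "{v \<in> space ?S. ?P v} \<in> sets ?S" by measurable
      show "AE \<omega> in M. Z \<omega> = z \<longrightarrow> ?P (?V \<omega>)"
        using irreversible by eventually_elim (auto simp: obs_treatment_def)
    qed
    then show ?thesis by (cases z) auto
  qed
  \<comment> \<open>\<open>h\<close> selects the outcome for the reduced form and the treatment status for the first stage.\<close>
  have contrast: "instrument_contrast M Z X
      = expectation (\<lambda>\<omega>. path_outcome (D 1 True \<omega>) (D 2 True \<omega>)
            (h (Y1 2 1 \<omega>) 1) (h (Y1 2 0 \<omega>) 1) (h (Y0 2 \<omega>) 0))
        - expectation (\<lambda>\<omega>. path_outcome (D 1 False \<omega>) (D 2 False \<omega>)
            (h (Y1 2 1 \<omega>) 1) (h (Y1 2 0 \<omega>) 1) (h (Y0 2 \<omega>) 0))"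
    if X: "X \<in> borel_measurable M" and h: "h = (\<lambda>y d. y) \<or> h = (\<lambda>y d. d)"
      and eq: "AE \<omega> in M. X \<omega> = path_outcome (D 1 (Z \<omega>) \<omega>) (D 2 (Z \<omega>) \<omega>)
            (h (Y1 2 1 \<omega>) 1) (h (Y1 2 0 \<omega>) 1) (h (Y0 2 \<omega>) 0)"
    for X and h :: "real \<Rightarrow> real \<Rightarrow> real"
  proof -
    let ?f = "\<lambda>z (_ :: real, _ :: real, y0, y10, y11, d1, d1', d2, d2').
      path_outcome (if z then d1 else d1') (if z then d2 else d2') (h y11 1) (h y10 1) (h y0 0)"
    have [measurable]: "(\<lambda>y. h y d) \<in> borel_measurable borel" for d using h by auto
    have f: "?f z \<in> borel_measurable ?S" for z
      unfolding path_outcome_def by measurable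
    have "integrable M (\<lambda>\<omega>. ?f z (?V \<omega>))" for z
    proof (rule Bochner_Integration.integrable_bound)
      \<comment> \<open>The absolute values dominate when \<open>h\<close> selects outcomes; the
        extra 1 dominates when it selects treatment statuses.\<close>
      show "integrable M (\<lambda>\<omega>. \<bar>Y0 2 \<omega>\<bar> + \<bar>Y1 2 0 \<omega>\<bar> + \<bar>Y1 2 1 \<omega>\<bar> + 1)" using Y by auto
      show "(\<lambda>\<omega>. ?f z (?V \<omega>)) \<in> borel_measurable M"
        using measurable_compose[OF V f] .
      show "AE \<omega> in M. norm (?f z (?V \<omega>)) \<le> norm (\<bar>Y0 2 \<omega>\<bar> + \<bar>Y1 2 0 \<omega>\<bar> + \<bar>Y1 2 1 \<omega>\<bar> + 1)"
        using h by (auto simp: path_outcome_def)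
    qed
    moreover have "AE \<omega> in M. X \<omega> = ?f (Z \<omega>) (?V \<omega>)"
      using eq by eventually_elim (auto simp: path_outcome_def)
    ultimately show ?thesis
      using instrument_contrast_indep[OF independence instrument_nondegenerate X f] by simp
  qed
  have ev: "compliers M D 1 \<in> events" "compliers M D 1 \<inter> always_takers M D 2 \<in> events"
     "never_takers M D 1 \<inter> defiers M D 2 \<in> events"
     "never_takers M D 1 \<inter> compliers M D 2 \<in> events"
    unfolding compliers_def always_takers_def never_takers_def defiers_def less_bool_def
    by measurable
  have "reduced_form M Z D Yz0 Yz1 2
      = expectation (\<lambda>\<omega>. path_outcome (D 1 True \<omega>) (D 2 True \<omega>) (Y1 2 1 \<omega>) (Y1 2 0 \<omega>) (Y0 2 \<omega>))
        - expectation (\<lambda>\<omega>. path_outcome (D 1 False \<omega>) (D 2 False \<omega>) (Y1 2 1 \<omega>) (Y1 2 0 \<omega>) (Y0 2 \<omega>))"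
    unfolding reduced_form_def
  proof (rule contrast[of _ "\<lambda>y d. y"])
    \<comment> \<open>Splitting on \<open>Z\<close> removes the random index, leaving only functions
      at a fixed instrument value, whose measurability is known.\<close>
    have "obs_outcome Z D Yz0 Yz1 2 = (\<lambda>\<omega>. if Z \<omega>
        then path_outcome (D 1 True \<omega>) (D 2 True \<omega>) (Yz1 2 1 True \<omega>) (Yz1 2 0 True \<omega>) (Yz0 2 True \<omega>)
        else path_outcome (D 1 False \<omega>) (D 2 False \<omega>) (Yz1 2 1 False \<omega>) (Yz1 2 0 False \<omega>)
          (Yz0 2 False \<omega>))"
      by (auto simp: obs_outcome_2 fun_eq_iff)
    also have "\<dots> \<in> borel_measurable M" unfolding path_outcome_def by measurable
    finally show "obs_outcome Z D Yz0 Yz1 2 \<in> borel_measurable M" .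
    show "AE \<omega> in M. obs_outcome Z D Yz0 Yz1 2 \<omega>
        = path_outcome (D 1 (Z \<omega>) \<omega>) (D 2 (Z \<omega>) \<omega>) (Y1 2 1 \<omega>) (Y1 2 0 \<omega>) (Y0 2 \<omega>)"
      \<comment> \<open>Exclusion has one null set per fixed \<open>z\<close>. Both must be
        discarded before \<open>z\<close> can be replaced by the random
        \<open>Z \<omega>\<close>.\<close>
      using ex[of True] ex[of False]
    proof eventually_elim
      case (elim \<omega>)
      then show ?case by (cases "Z \<omega>") (simp_all add: obs_outcome_2)
    qed
  qed simp
  \<comment> \<open>Here a - c is the effect at lag 1 and b - c the effect at lag 0.\<close>
  also note path_outcome_decomposition[OF treatment_rv Y(3,2,1) irr monotonicity]
  finally have RF: "reduced_form M Z D Yz0 Yz1 2 =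
       measure M (compliers M D 1) * causal_effect M Y0 Y1 2 1 (compliers M D 1)
       - measure M (compliers M D 1 \<inter> always_takers M D 2)
         * causal_effect M Y0 Y1 2 0 (compliers M D 1 \<inter> always_takers M D 2)
       - measure M (never_takers M D 1 \<inter> defiers M D 2)
         * causal_effect M Y0 Y1 2 0 (never_takers M D 1 \<inter> defiers M D 2)
       + measure M (never_takers M D 1 \<inter> compliers M D 2)
         * causal_effect M Y0 Y1 2 0 (never_takers M D 1 \<inter> compliers M D 2)"
    by (simp only: causal_effect_def ev[THEN measure_mult_cond_exp_on[OF finite_measure_axioms]])
  have "first_stage M Z D 2
      = expectation (\<lambda>\<omega>. path_outcome (D 1 True \<omega>) (D 2 True \<omega>) 1 1 0)
        - expectation (\<lambda>\<omega>. path_outcome (D 1 False \<omega>) (D 2 False \<omega>) 1 1 0)"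
    unfolding first_stage_def
  proof (rule contrast[of _ "\<lambda>y d. d"])
    have "(\<lambda>\<omega>. of_bool (obs_treatment Z D 2 \<omega>) :: real)
        = (\<lambda>\<omega>. if (if Z \<omega> then D 2 True \<omega> else D 2 False \<omega>) then 1 else 0)"
      by (auto simp: obs_treatment_def fun_eq_iff)
    also have "\<dots> \<in> borel_measurable M" by measurable
    finally show "(\<lambda>\<omega>. of_bool (obs_treatment Z D 2 \<omega>) :: real) \<in> borel_measurable M" .
    \<comment> \<open>The path outcome with values 1, 1, 0 records treatment by period 2, not in
      period 2. Irreversibility makes the two agree almost surely.\<close>
    show "AE \<omega> in M. of_bool (obs_treatment Z D 2 \<omega>)
        = path_outcome (D 1 (Z \<omega>) \<omega>) (D 2 (Z \<omega>) \<omega>) 1 1 0"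
      using irreversible by eventually_elim (auto simp: obs_treatment_def path_outcome_def)
  qed simp
  \<comment> \<open>With these values every effect equals 1, so each integral over a group is its
    probability.\<close>
  also note path_outcome_decomposition[OF treatment_rv _ _ _ irr monotonicity,
      where a = "\<lambda>_. 1" and b = "\<lambda>_. 1" and c = "\<lambda>_. 0"]
  finally have FS: "first_stage M Z D 2 =
       measure M (compliers M D 1)
       - measure M (compliers M D 1 \<inter> always_takers M D 2)
       - measure M (never_takers M D 1 \<inter> defiers M D 2)
       + measure M (never_takers M D 1 \<inter> compliers M D 2)"
    using ev by (simp add: set_lebesgue_integral_def)
  from RF FS show ?thesis by blast
qed

end
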